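(* Let $\mathcal{A}=\langle Q,\Sigma,\delta\rangle$ be a synchronizing automaton with $n$ states such that there exists a word $w\in\Sigma^*$ of length $s$ inducing a one-cluster transformation of $Q$ with level $\ell$ and cycle $C$ of length $m>1$. Then $\mathcal{A}$ has a reset word of length at most $$s(\ell+m-2)(m-1)+(n+1)(m-1)+s\ell-\sum_{k=1}^{m-1}D^*(m,k).$$
   Context: A (deterministic finite) automaton is a triple $\mathcal{A}=\langle Q,\Sigma,\delta\rangle$ with finite state set $Q$, input alphabet $\Sigma$, and complete transition function $\delta\colon Q\times\Sigma\to Q$, extended to words in the usual way; $qw$ is the state reached from $q$ by $w$, $Qw=\{qw:q\in Q\}$. A word $u$ is a reset word if $|Qu|=1$; $\mathcal{A}$ is synchronizing if it has a reset word. A word $w$ induces the transformation $q\mapsto qw$ of $Q$. A transformation $t\colon Q\to Q$ is one-cluster if for every $q,r\in Q$ there are $i,j\ge 1$ with $t^i(q)=t^j(r)$. Then $t$ has a unique cycle $C\subseteq Q$ (with $t(C)=C$, and $t$ permuting $C$ cyclically); the length of the cycle is $|C|$, and the level is the least $\ell\ge 0$ such that $t^\ell(Q)=C$. The number $D^*(m,k)$, $1\le k\le m-1$: for a $k$-element subset $S$ of the cyclically ordered set of $m$ positions $\mathbb{Z}/m\mathbb{Z}$, let $[S]=(c_1,\dots,c_m)\in\{0,1\}^m$ be its characteristic vector, let $V_S\subseteq\mathbb{Q}^m$ be the subspace spanned by the cyclic transforms $(c_1,\dots,c_m),(c_2,\dots,c_m,c_1),\dots,(c_m,c_1,\dots,c_{m-1})$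 of $[S]$, and let $q_S$ (the cyclic period of $S$) be the least $q\ge 1$ such that the cyclic shift of $S$ by $q$ positions equals $S$. Then $D^*(m,k)$ is the minimum of $m-q_S+\dim V_S$ over all $S$ with $|S|=k$. *)

theory Defs
  imports Complex_Main "HOL-Combinatorics.Orbits" "HOL-Library.Function_Algebras"
begin

locale automaton =
  fixes Q :: "'q set" and \<Sigma> :: "'a set" and \<delta> :: "'q \<Rightarrow> 'a \<Rightarrow> 'q"
  assumes finite_states: "finite Q"
    and complete: "\<And>q a. q \<in> Q \<Longrightarrow> a \<in> \<Sigma> \<Longrightarrow> \<delta> q a \<in> Q"

definition act :: "('q \<Rightarrow> 'a \<Rightarrow> 'q) \<Rightarrow> 'a list \<Rightarrow> 'q \<Rightarrow> 'q" where
  "act \<delta> w q = foldl \<delta> q w"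

definition reset_word :: "'q set \<Rightarrow> 'a set \<Rightarrow> ('q \<Rightarrow> 'a \<Rightarrow> 'q) \<Rightarrow> 'a list \<Rightarrow> bool" where
  "reset_word Q \<Sigma> \<delta> u \<longleftrightarrow> u \<in> lists \<Sigma> \<and> card (act \<delta> u ` Q) = 1"

definition synchronizing :: "'q set \<Rightarrow> 'a set \<Rightarrow> ('q \<Rightarrow> 'a \<Rightarrow> 'q) \<Rightarrow> bool" where
  "synchronizing Q \<Sigma> \<delta> \<longleftrightarrow> (\<exists>u. reset_word Q \<Sigma> \<delta> u)"

definition one_cluster :: "'q set \<Rightarrow> ('q \<Rightarrow> 'q) \<Rightarrow> bool" where
  "one_cluster Q t \<longleftrightarrow> t ` Q \<subseteq> Q \<and>
     (\<forall>q\<in>Q. \<forall>r\<in>Q. \<exists>i\<ge>1. \<exists>j\<ge>1. (t ^^ i) q = (t ^^ j) r)"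

text \<open>The library predicate \<open>cyclic_on t C\<close> says that \<open>C\<close> is the forward orbit of one of its own
  points; thus \<open>C\<close> is finite and nonempty, and \<open>t\<close> permutes it in a single cycle (cf. \<open>finite_cyclic_on\<close>).\<close>

definition is_cycle :: "'q set \<Rightarrow> ('q \<Rightarrow> 'q) \<Rightarrow> 'q set \<Rightarrow> bool" where
  "is_cycle Q t C \<longleftrightarrow> C \<subseteq> Q \<and> cyclic_on t C"

definition level :: "'q set \<Rightarrow> ('q \<Rightarrow> 'q) \<Rightarrow> 'q set \<Rightarrow> nat" where
  "level Q t C = (LEAST l. (t ^^ l) ` Q = C)"

text \<open>The space \<open>\<rat>\<^sup>m\<close> is represented by the functions \<open>nat \<Rightarrow> rat\<close> that vanish outside
  \<open>{..<m}\<close>; the positions in \<open>\<int>/m\<int>\<close> are \<open>0, \<dots>, m - 1\<close>. Scalars act pointwise.\<close>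

definition rscale :: "rat \<Rightarrow> (nat \<Rightarrow> rat) \<Rightarrow> nat \<Rightarrow> rat" where
  "rscale c f = (\<lambda>i. c * f i)"

interpretation ratvec: vector_space rscale
  by unfold_locales (auto simp: rscale_def fun_eq_iff algebra_simps)

definition cyc_transform :: "nat \<Rightarrow> nat set \<Rightarrow> nat \<Rightarrow> nat \<Rightarrow> rat" where
  "cyc_transform m S j = (\<lambda>i. if i < m then of_bool ((i + j) mod m \<in> S) else 0)"

definition cyc_span :: "nat \<Rightarrow> nat set \<Rightarrow> (nat \<Rightarrow> rat) set" where
  "cyc_span m S = ratvec.span (cyc_transform m S ` {..<m})"

definition cyc_period :: "nat \<Rightarrow> nat set \<Rightarrow> nat" where
  "cyc_period m S = (LEAST q. q \<ge> 1 \<and> (\<lambda>i. (i + q) mod m) ` S = S)"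

lemma cyc_period_le:
  assumes "S \<subseteq> {..<m}" and "m \<ge> 1"
  shows "cyc_period m S \<le> m"
proof -
  have "(\<lambda>i. (i + m) mod m) ` S = id ` S"
    using assms(1) by (intro image_cong) auto
  then show ?thesis
    unfolding cyc_period_def using assms(2) by (intro Least_le) simp
qed

text \<open>By \<open>cyc_period_le\<close>, the natural-number subtraction below does not truncate.\<close>

definition Dstar :: "nat \<Rightarrow> nat \<Rightarrow> nat" where
  "Dstar m k = Min ((\<lambda>S. m - cyc_period m S + ratvec.dim (cyc_span m S))
                      ` {S. S \<subseteq> {..<m} \<and> card S = k})"

end

theory Submission
  imports Defs
begin

text \<open>For \<open>S \<subseteq> C\<close> with \<open>k\<close> elements let \<open>f\<^sub>j\<close> be the indicator of \<open>{q. q w\<^sup>l\<^sup>+\<^sup>j \<in> S}\<close> and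
  \<open>g\<^sub>j = f\<^sub>j - k/m\<close>. Each \<open>g\<^sub>j\<close> sums to \<open>0\<close> over \<open>C\<close>, and the \<open>g\<^sub>j\<close> span a space of dimension at
  least \<open>dim V\<^sub>S - 1\<close>. A reset word maps them to nonzero constants, so letting words of growing
  length act yields a strictly increasing chain of spaces that leaves the hyperplane of functions
  with sum \<open>0\<close> over \<open>C\<close> after at most \<open>n + 1 - dim V\<^sub>S\<close> letters. For the word \<open>u\<close> found this way the
  sizes of \<open>{q \<in> C. q u w\<^sup>l\<^sup>+\<^sup>j \<in> S}\<close> are not all \<open>k\<close>; but over a period of \<open>j\<close> they average to \<open>k\<close>, so
  some \<open>j < q\<^sub>S\<close> gives more than \<open>k\<close>. Starting from a point of the cycle, at most \<open>m - 1\<close> such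
  expansions produce \<open>C\<close>, and a prefix \<open>w\<^sup>l\<close> maps \<open>Q\<close> into \<open>C\<close>. In the first expansion \<open>j = 0\<close> can be
  arranged by choosing the point; these saved \<open>m - 1\<close> copies of \<open>w\<close> turn \<open>l + m - 1\<close> into
  \<open>l + m - 2\<close> in all \<open>m - 1\<close> summands of the bound.\<close>

subsection \<open>Words acting linearly\<close>

text \<open>A shortest word \<open>v\<close> moving an element of \<open>B\<close> out of
  \<open>K\<close> is short enough. The images of \<open>B\<close> under words of length at most
  \<open>i\<close> span subspaces that grow strictly for \<open>i < length v\<close>, starting with
  dimension at least \<open>card D\<close>; below \<open>length v\<close> they stay in
  \<open>K\<close>, and \<open>z\<close> keeps one dimension of \<open>span E\<close> outside
  \<open>K\<close>.\<close>

lemma (in vector_space) short_word_leaving_subspace: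
  fixes T :: "'c \<Rightarrow> 'b \<Rightarrow> 'b"
  assumes lin: "\<And>a. a \<in> A \<Longrightarrow> module_hom scale scale (T a)"
    and T_E: "\<And>a x. a \<in> A \<Longrightarrow> x \<in> span E \<Longrightarrow> T a x \<in> span E"
    and fin: "finite E" and BE: "B \<subseteq> span E"
    and K: "subspace K" and BK: "B \<subseteq> K"
    and D: "independent D" "D \<subseteq> B"
    and z: "z \<in> span E" "z \<notin> K"
    and u: "u \<in> lists A" "x \<in> B" "foldr T u x \<notin> K"
  shows "\<exists>v\<in>lists A. length v + card D \<le> card E \<and> (\<exists>y\<in>B. foldr T v y \<notin> K)"
proof -
  define G where "G i = {foldr T v y | v y. v \<in> lists A \<and> length v \<le> i \<and> y \<in> B}" for i
  define P where "P v \<longleftrightarrow> v \<in> lists A \<and> (\<exists>y\<in>B. foldr T v y \<notin> K)" for v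
  have "P u" using u by (auto simp: P_def)
  then obtain v where v: "P v" and least: "\<And>v'. P v' \<Longrightarrow> length v \<le> length v'"
    using ex_has_least_nat[of P u length] by blast
  have foldr_E: "foldr T v' y \<in> span E" if "v' \<in> lists A" "y \<in> B" for v' y
    using that BE by (induction v') (auto intro: T_E)
  have GE: "span (G i) \<subseteq> span E" for i
    by (intro span_minimal subspace_span) (auto simp: G_def intro!: foldr_E)
  have GK: "span (G i) \<subseteq> K" if "i < length v" for i
    using that least by (intro span_minimal K) (fastforce simp: G_def P_def)
  \<comment> \<open>Otherwise \<open>span (G i)\<close> would be invariant under every
    \<open>T a\<close> and contain \<open>foldr T u x\<close>, although it lies in
    \<open>K\<close>.\<close>
  have grow: "\<exists>y\<in>G (Suc i). y \<notin> span (G i)" if i: "i < length v" for i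
  proof (rule ccontr)
    assume "\<not> ?thesis"
    then have closed: "G (Suc i) \<subseteq> span (G i)" by blast
    have T_span: "T a y \<in> span (G i)" if a: "a \<in> A" and y: "y \<in> span (G i)" for a y
    proof -
      interpret module_hom scale scale "T a" by (rule lin[OF a])
      have "T a ` G i \<subseteq> G (Suc i)"
      proof
        fix g assume "g \<in> T a ` G i"
        then obtain v' y' where "g = foldr T (a # v') y'" "v' \<in> lists A" "length v' \<le> i" "y' \<in> B"
          by (auto simp: G_def)
        then show "g \<in> G (Suc i)" using a unfolding G_def
          by (intro CollectI exI[of _ "a # v'"] exI[of _ y']) auto
      qed
      then have "T a ` span (G i) \<subseteq> span (G i)"
        using closed by (subst span_image[symmetric]) (intro span_minimal subspace_span, auto)
      then show ?thesis using y by blast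
    qed
    have "foldr T v' y \<in> span (G i)" if "v' \<in> lists A" "y \<in> B" for v' y
      using that
    proof (induction v')
      case Nil
      then show ?case by (auto simp: G_def intro!: span_base exI[of _ "[]"])
    qed (auto intro: T_span)
    then show False using GK[OF i] u by blast
  qed
  have D_fin: "finite D"
    using independent_span_bound[OF fin D(1)] D(2) BE by auto
  have chain: "\<exists>I. finite I \<and> independent I \<and> I \<subseteq> span (G i) \<and> card I = card D + i"
    if "i < length v" for i
    using that
  proof (induction i)
    case 0
    have "D \<subseteq> span (G 0)"
      using D(2) by (auto simp: G_def intro!: span_base)
    then show ?case using D D_fin by auto
  next
    case (Suc i)
    then obtain I where I: "finite I" "independent I" "I \<subseteq> span (G i)" "card I = card D + i"
      by auto
    obtain y where y: "y \<in> G (Suc i)" "y \<notin> span (G i)"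
      using grow[of i] Suc.prems by auto
    have sub: "span I \<subseteq> span (G i)" by (rule span_minimal[OF I(3) subspace_span])
    have "G i \<subseteq> G (Suc i)" by (fastforce simp: G_def)
    then have "I \<subseteq> span (G (Suc i))" using I(3) span_mono by blast
    then have "insert y I \<subseteq> span (G (Suc i))" using y(1) by (auto intro: span_base)
    moreover have "independent (insert y I)" using sub y(2) I(2) by (intro independent_insertI) auto
    moreover have "y \<notin> I" using y(2) I(3) by auto
    ultimately show ?case using I by (intro exI[of _ "insert y I"]) auto
  qed
  \<comment> \<open>The empty word does not leave \<open>K\<close>, so the space for
    \<open>length v - 1\<close> exists and lies in \<open>K\<close>; adding \<open>z\<close> makes
    up for the lost unit.\<close>
  have "length v \<noteq> 0" using v BK by (auto simp: P_def)
  then obtain i where i: "length v = Suc i" by (cases "length v") auto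
  obtain I where I: "finite I" "independent I" "I \<subseteq> span (G i)" "card I = card D + i"
    using chain[of i] i by auto
  have IK: "span I \<subseteq> K"
    using GK[of i] i span_minimal[OF I(3) subspace_span] by auto
  have "independent (insert z I)" using IK z(2) I(2) by (intro independent_insertI) auto
  moreover have "insert z I \<subseteq> span E" using z(1) I(3) GE by auto
  ultimately have "card (insert z I) \<le> card E" using independent_span_bound[OF fin] by blast
  moreover have "z \<notin> I" using IK z(2) span_superset[of I] by auto
  ultimately have "length v + card D \<le> card E" using I i by simp
  then show ?thesis using v by (auto simp: P_def)
qed

text \<open>Counterpart of \<open>rscale\<close> for any domain, applied below to functions on
  states.\<close>

definition fscale :: "rat \<Rightarrow> ('x \<Rightarrow> rat) \<Rightarrow> 'x \<Rightarrow> rat" where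
  "fscale c f = (\<lambda>x. c * f x)"

interpretation funvec: vector_space fscale
  by unfold_locales (auto simp: fscale_def fun_eq_iff algebra_simps)

lemma in_span_delta:
  assumes "finite Q" and "\<And>q. q \<notin> Q \<Longrightarrow> f q = 0"
  shows "f \<in> funvec.span ((\<lambda>p q. of_bool (q = p)) ` Q)"
proof -
  have sum_app: "(\<Sum>p\<in>A. h p) q = (\<Sum>p\<in>A. h p q)" for h :: "'a \<Rightarrow> 'a \<Rightarrow> rat" and A q
    by (induction A rule: infinite_finite_induct) auto
  have "f = (\<Sum>p\<in>Q. fscale (f p) (\<lambda>q. of_bool (q = p)))"
    using assms by (auto simp: fun_eq_iff sum_app fscale_def if_distrib of_bool_def cong: if_cong)
  also have "\<dots> \<in> funvec.span ((\<lambda>p q. of_bool (q = p)) ` Q)"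
    by (intro funvec.span_sum funvec.span_scale funvec.span_base) auto
  finally show ?thesis .
qed

subsection \<open>Cyclic periods and \<open>D\<^sup>*\<close>\<close>

lemma sum_periodic_shift:
  fixes h :: "nat \<Rightarrow> 'a::ab_group_add"
  assumes "\<And>i. h (i + m) = h i"
  shows "(\<Sum>j<m. h (p + j)) = (\<Sum>j<m. h j)"
proof (induction p)
  case (Suc p)
  have "(\<Sum>j<m. h (Suc p + j)) + h p = (\<Sum>j<Suc m. h (p + j))"
    by (subst sum.lessThan_Suc_shift) (simp add: add.commute)
  also have "\<dots> = (\<Sum>j<m. h (p + j)) + h p" using assms[of p] by simp
  finally show ?case using Suc by simp
qed simp

lemma mod_add_rcancel_nat:
  fixes i j q m :: nat
  assumes "(i + q) mod m = (j + q) mod m"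
  shows "i mod m = j mod m"
proof -
  have "(int i + int q) mod int m = (int j + int q) mod int m"
    using assms by (metis of_nat_add zmod_int)
  then have "int i mod int m = int j mod int m"
    by (simp add: mod_eq_dvd_iff)
  then show ?thesis by (simp flip: zmod_int)
qed

lemma cyc_period:
  assumes "S \<subseteq> {..<m}" and "m \<ge> 1"
  shows "cyc_period m S \<ge> 1" and "(\<lambda>i. (i + cyc_period m S) mod m) ` S = S"
proof -
  have "(\<lambda>i. (i + m) mod m) ` S = id ` S"
    using assms(1) by (intro image_cong) auto
  then have "\<exists>q. q \<ge> 1 \<and> (\<lambda>i. (i + q) mod m) ` S = S"
    using assms(2) by (intro exI[of _ m]) simp
  from LeastI_ex[OF this] show "cyc_period m S \<ge> 1" "(\<lambda>i. (i + cyc_period m S) mod m) ` S = S"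
    unfolding cyc_period_def by auto
qed

text \<open>Shifting by the period preserves membership in both directions, the converse because
  shifts are injective modulo \<open>m\<close>. This later bounds the exponent \<open>j\<close> by
  the period instead of \<open>m\<close>.\<close>

lemma mod_cyc_period:
  assumes S: "S \<subseteq> {..<m}" and m: "m \<ge> 1"
  shows "(i + j mod cyc_period m S) mod m \<in> S \<longleftrightarrow> (i + j) mod m \<in> S"
proof -
  define q where "q = cyc_period m S"
  have im: "(\<lambda>i. (i + q) mod m) ` S = S"
    using cyc_period[OF assms] by (simp add: q_def)
  have step: "(i + q) mod m \<in> S \<longleftrightarrow> i mod m \<in> S" for i
  proof
    assume "i mod m \<in> S"
    then have "(i mod m + q) mod m \<in> S" using im by blast
    then show "(i + q) mod m \<in> S" by (simp add: mod_add_left_eq)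
  next
    assume "(i + q) mod m \<in> S"
    then have "(i + q) mod m \<in> (\<lambda>i. (i + q) mod m) ` S" by (simp only: im)
    then obtain i' where i': "i' \<in> S" "(i + q) mod m = (i' + q) mod m" by blast
    have "i mod m = i' mod m" using i'(2)
      by (rule mod_add_rcancel_nat)
    moreover have "i' mod m = i'" using i'(1) S by auto
    ultimately show "i mod m \<in> S" using i'(1) by simp
  qed
  have steps: "(i + r + k * q) mod m \<in> S \<longleftrightarrow> (i + r) mod m \<in> S" for r k
  proof (induction k)
    case (Suc k)
    then show ?case using step[of "i + r + k * q"] by (simp add: algebra_simps)
  qed simp
  show ?thesis using steps[of "j mod q" "j div q"]
    by (simp add: q_def[symmetric] add.assoc)
qed

lemma dim_cyc_span_le: "ratvec.dim (cyc_span m S) \<le> m"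
proof -
  have "ratvec.dim (cyc_span m S) \<le> card (cyc_transform m S ` {..<m})"
    unfolding cyc_span_def by (intro ratvec.dim_le_card) auto
  also have "\<dots> \<le> m" using card_image_le[of "{..<m}" "cyc_transform m S"] by simp
  finally show ?thesis .
qed

lemma Dstar_le:
  assumes "S \<subseteq> {..<m}"
  shows "Dstar m (card S) \<le> m - cyc_period m S + ratvec.dim (cyc_span m S)"
  unfolding Dstar_def using assms by (intro Min_le) auto

text \<open>The set \<open>{..<k}\<close> witnesses this crude bound, which keeps the later step
  costs nonnegative.\<close>

lemma Dstar_less:
  assumes "1 \<le> k" "k \<le> m"
  shows "Dstar m k < 2 * m"
proof -
  have "cyc_period m {..<k} \<ge> 1" using assms by (intro cyc_period) auto
  then show ?thesis using Dstar_le[of "{..<k}" m] dim_cyc_span_le[of m "{..<k}"] assms by simp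
qed

subsection \<open>One-cluster transformations\<close>

lemma act_simps [simp]:
  "act \<delta> [] q = q" "act \<delta> (a # u) q = act \<delta> u (\<delta> q a)" "act \<delta> (u @ v) q = act \<delta> v (act \<delta> u q)"
  by (auto simp: act_def)

lemma act_power: "act \<delta> (concat (replicate i w)) q = (act \<delta> w ^^ i) q"
  by (induction i arbitrary: q) (auto simp: funpow_swap1)

lemma length_power: "length (concat (replicate i w)) = length w * i"
  by (induction i) auto

lemma (in automaton) act_in: "u \<in> lists \<Sigma> \<Longrightarrow> q \<in> Q \<Longrightarrow> act \<delta> u q \<in> Q"
  by (induction u arbitrary: q) (auto intro: complete)

text \<open>The enumeration runs up to the first return time of \<open>c\<close>, which therefore
  equals \<open>card C\<close>.\<close>

lemma cyclic_on_enum: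
  assumes "cyclic_on t C"
  obtains c where "bij_betw (\<lambda>i. (t ^^ i) c) {..<card C} C" and "(t ^^ card C) c = c"
proof -
  obtain c where c: "c \<in> orbit t c" "C = orbit t c" using assms by (auto simp: cyclic_on_def)
  define d where "d = funpow_dist1 t c c"
  have inj: "inj_on (\<lambda>i. (t ^^ i) c) {..<d}"
    using inj_on_funpow_dist1[OF c(1)] unfolding d_def[symmetric] by (simp add: atLeast0LessThan)
  have im: "C = (\<lambda>i. (t ^^ i) c) ` {..<d}"
    using orbit_conv_funpow_dist1[OF c(1)] c(2) unfolding d_def[symmetric] by (simp add: atLeast0LessThan)
  have "card C = d" using im card_image[OF inj] by simp
  moreover have "(t ^^ d) c = c" using funpow_dist1_prop[OF c(1)] by (simp only: d_def)
  ultimately show ?thesis using that[of c] inj im by (simp add: bij_betw_def)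
qed

text \<open>The least number in \<open>level\<close> is attained once some exponent works. The
  largest entry time into \<open>C\<close> does: \<open>t\<close> maps \<open>C\<close> onto itself,
  so states that have entered stay and all of \<open>C\<close> is covered.\<close>

lemma level_image:
  assumes "finite Q" and "one_cluster Q t" and cyc: "is_cycle Q t C"
  shows "(t ^^ level Q t C) ` Q = C"
proof -
  have CQ: "C \<subseteq> Q" and on: "cyclic_on t C" using cyc by (auto simp: is_cycle_def)
  have inC: "x \<in> C \<Longrightarrow> (t ^^ i) x \<in> C" for i x using cyclic_on_funpow_in[OF on] .
  obtain c where c: "c \<in> C" using on by (auto simp: cyclic_on_def)
  have "\<exists>i. (t ^^ i) q \<in> C" if "q \<in> Q" for q
    using assms(2) that c CQ inC unfolding one_cluster_def by (metis subsetD)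
  then obtain f where f: "\<And>q. q \<in> Q \<Longrightarrow> (t ^^ f q) q \<in> C" by metis
  define N where "N = Max (insert 0 (f ` Q))"
  have "(t ^^ N) q \<in> C" if q: "q \<in> Q" for q
  proof -
    have "f q \<le> N" using q assms(1) by (simp add: N_def)
    then have "N = (N - f q) + f q" by simp
    then have "(t ^^ N) q = (t ^^ (N - f q)) ((t ^^ f q) q)" by (metis comp_apply funpow_add)
    then show ?thesis using f[OF q] inC by simp
  qed
  moreover have "t ` C = C"
  proof
    show "t ` C \<subseteq> C" using cyclic_on_inI[OF on] by auto
    obtain s where s: "s \<in> C" "C = orbit t s" using on by (auto simp: cyclic_on_def)
    show "C \<subseteq> t ` C"
    proof
      fix x assume "x \<in> C"
      then have "x \<in> orbit t s" using s by simp
      then show "x \<in> t ` C" by cases (use s in auto)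
    qed
  qed
  then have "(t ^^ i) ` C = C" for i
    by (induction i) (simp_all only: funpow.simps image_comp[symmetric] image_id id_apply)
  then have "C \<subseteq> (t ^^ N) ` Q" using CQ by (metis image_mono)
  ultimately have "(t ^^ N) ` Q = C" by auto
  then show ?thesis unfolding level_def by (rule LeastI)
qed

subsection \<open>Expanding subsets of the cycle\<close>

text \<open>The base point \<open>c\<close> identifies the cycle with the positions modulo
  \<open>m\<close>.\<close>

locale cluster_word = automaton Q \<Sigma> \<delta>
  for Q :: "'q set" and \<Sigma> :: "'a set" and \<delta> :: "'q \<Rightarrow> 'a \<Rightarrow> 'q" +
  fixes w :: "'a list" and C :: "'q set" and c :: 'q and l m :: nat
  assumes sync: "synchronizing Q \<Sigma> \<delta>"
    and w: "w \<in> lists \<Sigma>"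
    and CQ: "C \<subseteq> Q"
    and enum: "bij_betw (\<lambda>i. (act \<delta> w ^^ i) c) {..<m} C"
    and period: "(act \<delta> w ^^ m) c = c"
    and level: "(act \<delta> w ^^ l) ` Q = C"
    and m: "m > 1"
begin

abbreviation "t \<equiv> act \<delta> w"

text \<open>Every state of \<open>Q\<close> is on the cycle after \<open>l\<close> steps; from then
  on only its position there matters.\<close>

definition pos :: "'q \<Rightarrow> nat" where
  "pos q = inv_into {..<m} (\<lambda>i. (t ^^ i) c) ((t ^^ l) q)"

definition idx :: "'q set \<Rightarrow> nat set" where
  "idx S = {i. i < m \<and> (t ^^ i) c \<in> S}"

text \<open>The word \<open>u\<close> followed by \<open>l + j\<close> copies of \<open>w\<close>
  expands \<open>S\<close> when this count exceeds \<open>card S\<close>.\<close>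

definition hits :: "'q set \<Rightarrow> 'a list \<Rightarrow> nat \<Rightarrow> nat" where
  "hits S u j = card {q \<in> C. (t ^^ (l + j)) (act \<delta> u q) \<in> S}"

lemma finite_C: "finite C"
  using CQ finite_states finite_subset by auto

lemma card_C: "card C = m"
  using bij_betw_same_card[OF enum] by simp

lemma power_word: "concat (replicate i w) \<in> lists \<Sigma>"
  using w by auto

lemma pos:
  assumes "q \<in> Q"
  shows "pos q < m" and "(t ^^ pos q) c = (t ^^ l) q"
proof -
  have *: "(t ^^ l) q \<in> (\<lambda>i. (t ^^ i) c) ` {..<m}"
    using imageI[OF assms, of "t ^^ l"] by (simp only: level bij_betw_imp_surj_on[OF enum])
  show "pos q < m" using inv_into_into[OF *] by (simp add: pos_def)
  show "(t ^^ pos q) c = (t ^^ l) q" using f_inv_into_f[OF *] by (simp add: pos_def)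
qed

lemma pos_surj: "i < m \<Longrightarrow> \<exists>q\<in>Q. pos q = i"
proof -
  assume i: "i < m"
  then have "(t ^^ i) c \<in> (t ^^ l) ` Q" using bij_betwE[OF enum] by (simp add: level)
  then obtain q where q: "q \<in> Q" "(t ^^ l) q = (t ^^ i) c" by auto
  have "pos q = i" unfolding pos_def q(2)
    using i by (intro inv_into_f_f bij_betw_imp_inj_on[OF enum]) simp
  then show ?thesis using q by blast
qed

lemma funpow_c_mod: "(t ^^ (i mod m)) c = (t ^^ i) c"
  using funpow_mod_eq[OF period] by simp

lemma funpow_pos: "q \<in> Q \<Longrightarrow> (t ^^ (l + j)) q = (t ^^ (pos q + j)) c"
  using pos(2)[of q] by (simp add: add.commute[of l] add.commute[of "pos q"] funpow_add)

lemma funpow_pos_in_iff: "q \<in> Q \<Longrightarrow> (t ^^ (l + j)) q \<in> S \<longleftrightarrow> (pos q + j) mod m \<in> idx S"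
  using m by (simp add: funpow_pos idx_def funpow_c_mod)

lemma idx_subset: "idx S \<subseteq> {..<m}"
  by (auto simp: idx_def)

lemma card_idx: "S \<subseteq> C \<Longrightarrow> card (idx S) = card S"
proof -
  assume "S \<subseteq> C"
  then have "(\<lambda>i. (t ^^ i) c) ` idx S = S" using bij_betw_imp_surj_on[OF enum]
    by (auto simp: idx_def)
  moreover have "inj_on (\<lambda>i. (t ^^ i) c) (idx S)"
    using inj_on_subset[OF bij_betw_imp_inj_on[OF enum] idx_subset] .
  ultimately show ?thesis using card_image by fastforce
qed

lemma sum_orbit:
  assumes "S \<subseteq> C"
  shows "(\<Sum>j<m. of_bool ((t ^^ (p + j)) c \<in> S)) = (of_nat (card S) :: rat)"
proof -
  have "(\<Sum>j<m. of_bool ((t ^^ (p + j)) c \<in> S)) = (\<Sum>j<m. of_bool ((t ^^ j) c \<in> S) :: rat)"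
    by (rule sum_periodic_shift) (simp add: funpow_add period)
  also have "\<dots> = of_nat (card (idx S))" by (simp add: idx_def Int_def)
  finally show ?thesis using assms by (simp add: card_idx)
qed

text \<open>Double counting: for each \<open>q\<close> in \<open>C\<close>, the states reached for
  \<open>j < m\<close> run once around the cycle and meet \<open>S\<close> exactly
  \<open>card S\<close> times.\<close>

lemma sum_hits:
  assumes S: "S \<subseteq> C" and u: "u \<in> lists \<Sigma>"
  shows "(\<Sum>j<m. hits S u j) = m * card S"
proof -
  have "(of_nat (\<Sum>j<m. hits S u j) :: rat) =
      (\<Sum>j<m. \<Sum>q\<in>C. of_bool ((t ^^ (l + j)) (act \<delta> u q) \<in> S))"
    using finite_C by (simp add: hits_def Int_def)
  also have "\<dots> = (\<Sum>q\<in>C. \<Sum>j<m. of_bool ((t ^^ (l + j)) (act \<delta> u q) \<in> S))"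
    by (rule sum.swap)
  also have "\<dots> = (\<Sum>q\<in>C. of_nat (card S))"
    using CQ act_in[OF u]
    by (intro sum.cong refl) (simp only: funpow_pos sum_orbit[OF S] subset_iff)
  also have "\<dots> = of_nat (m * card S)" by (simp add: card_C)
  finally show ?thesis by (simp only: of_nat_eq_iff)
qed

text \<open>\<open>short_word_leaving_subspace\<close> is applied to the centred indicators
  \<open>g j\<close> and the hyperplane \<open>K\<close>; a basis \<open>D\<close> of their span has
  at least \<open>dim\<close> of the cyclic span minus one elements.\<close>

lemma short_unbalanced_word:
  assumes S: "S \<subseteq> C" and k: "0 < card S" "card S < m"
  shows "\<exists>u\<in>lists \<Sigma>. length u + ratvec.dim (cyc_span m (idx S)) \<le> card Q + 1 \<and>
    (\<exists>j<m. hits S u j \<noteq> card S)"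
proof -
  define z :: "'q \<Rightarrow> rat" where "z = (\<lambda>q. of_bool (q \<in> Q))"
  define f :: "nat \<Rightarrow> 'q \<Rightarrow> rat" where "f j = (\<lambda>q. of_bool (q \<in> Q \<and> (t ^^ (l + j)) q \<in> S))" for j
  \<comment> \<open>This is the mean of each \<open>f j\<close> over \<open>C\<close>, so
    \<open>g j\<close> has sum zero there.\<close>
  define r :: rat where "r = of_nat (card S) / of_nat m"
  define g where "g j = f j - fscale r z" for j
  \<comment> \<open>Letters act by precomposition. \<open>foldr\<close> puts the first letter
    outermost, so a word \<open>u\<close> precomposes with \<open>act \<delta> u\<close>.\<close>
  define T :: "'a \<Rightarrow> ('q \<Rightarrow> rat) \<Rightarrow> 'q \<Rightarrow> rat"
    where "T a h = (\<lambda>q. if q \<in> Q then h (\<delta> q a) else 0)" for a h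
  define K where "K = {h :: 'q \<Rightarrow> rat. (\<Sum>q\<in>C. h q) = 0}"
  define B where "B = g ` {..<m}"
  define E :: "('q \<Rightarrow> rat) set" where "E = (\<lambda>p q. of_bool (q = p)) ` Q"
  have in_E: "h \<in> funvec.span E" if "\<And>q. q \<notin> Q \<Longrightarrow> h q = 0" for h
    unfolding E_def using in_span_delta[OF finite_states] that by blast
  have g_app: "g j q = (if q \<in> Q then of_bool ((t ^^ (l + j)) q \<in> S) - r else 0)" for j q
    by (simp add: g_def f_def z_def fscale_def)
  have r_mult: "r * of_nat m = of_nat (card S)" using m by (simp add: r_def)
  have T_word: "foldr T u (g j) = (\<lambda>q. if q \<in> Q then g j (act \<delta> u q) else 0)"
    if "u \<in> lists \<Sigma>" for u j
    using that
  proof (induction u)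
    case Nil
    show ?case by (auto simp: g_app fun_eq_iff)
  next
    case (Cons a u)
    then show ?case by (auto simp: T_def fun_eq_iff complete)
  qed
  have sum_word: "(\<Sum>q\<in>C. foldr T u (g j) q) = of_nat (hits S u j) - of_nat (card S)"
    if u: "u \<in> lists \<Sigma>" for u j
  proof -
    have "(\<Sum>q\<in>C. foldr T u (g j) q) = (\<Sum>q\<in>C. of_bool ((t ^^ (l + j)) (act \<delta> u q) \<in> S) - r)"
      using CQ act_in[OF u] by (intro sum.cong) (auto simp: T_word[OF u] g_app)
    also have "\<dots> = of_nat (hits S u j) - r * of_nat m"
      using finite_C by (simp add: sum_subtractf hits_def Int_def card_C)
    finally show ?thesis by (simp add: r_mult)
  qed
  have B_K: "B \<subseteq> K"
  proof -
    have "(\<Sum>q\<in>C. g j q) = 0" for j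
    proof -
      have "(\<Sum>q\<in>C. g j q) = (\<Sum>q\<in>C. of_bool ((t ^^ (l + j)) q \<in> S) - r)"
        using CQ by (intro sum.cong) (auto simp: g_app)
      also have "\<dots> = (\<Sum>q\<in>C. of_bool ((t ^^ (l + j)) q \<in> S)) - r * of_nat m"
        by (simp add: sum_subtractf card_C)
      also have "(\<Sum>q\<in>C. of_bool ((t ^^ (l + j)) q \<in> S) :: rat) =
          (\<Sum>i<m. of_bool ((t ^^ (l + j + i)) c \<in> S))"
        by (subst sum.reindex_bij_betw[OF enum, symmetric]) (simp add: funpow_add)
      finally show ?thesis by (simp only: sum_orbit[OF S] r_mult diff_self)
    qed
    then show ?thesis by (auto simp: B_def K_def)
  qed
  have K_sub: "funvec.subspace K"
    by (auto simp: funvec.subspace_def K_def sum.distrib fscale_def simp flip: sum_distrib_left)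
  have T_lin: "module_hom fscale fscale (T a)" for a
    by unfold_locales (auto simp: T_def fscale_def fun_eq_iff)
  have z_E: "z \<in> funvec.span E" by (rule in_E) (simp add: z_def)
  have "(\<Sum>q\<in>C. z q) = of_nat m" using CQ finite_C by (simp add: z_def Int_def card_C[symmetric] subset_iff cong: conj_cong)
  then have z_K: "z \<notin> K" using m by (simp add: K_def)
  have B_E: "B \<subseteq> funvec.span E" by (auto simp: B_def g_app intro!: in_E)
  obtain D where D: "D \<subseteq> B" "funvec.independent D" "B \<subseteq> funvec.span D"
    using funvec.maximal_independent_subset by blast
  have E_fin: "finite E" using finite_states by (simp add: E_def)
  have D_fin: "finite D" using D(1) finite_subset by (auto simp: B_def)
  obtain v p where v: "v \<in> lists \<Sigma>" "act \<delta> v ` Q = {p}"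
    using sync by (auto simp: synchronizing_def reset_word_def card_1_singleton_iff)
  \<comment> \<open>A reset word sends all of \<open>C\<close> to one state, so the count is
    \<open>0\<close> or \<open>m\<close>, never \<open>card S\<close>.\<close>
  have "foldr T v (g 0) \<notin> K"
  proof
    assume "foldr T v (g 0) \<in> K"
    then have "hits S v 0 = card S" using sum_word[OF v(1)] by (simp add: K_def)
    moreover have "hits S v 0 = (if (t ^^ l) p \<in> S then m else 0)"
    proof -
      have "act \<delta> v q = p" if "q \<in> C" for q using that v(2) CQ by auto
      then have "{q \<in> C. (t ^^ (l + 0)) (act \<delta> v q) \<in> S} = (if (t ^^ l) p \<in> S then C else {})"
        by auto
      then show ?thesis by (simp add: hits_def card_C)
    qed
    ultimately show False using k by (auto split: if_splits)
  qed
  moreover have "g 0 \<in> B" using m by (auto simp: B_def)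
  moreover have T_E: "T a h \<in> funvec.span E" for a h by (rule in_E) (simp add: T_def)
  ultimately have "\<exists>u\<in>lists \<Sigma>. length u + card D \<le> card E \<and> (\<exists>y\<in>B. foldr T u y \<notin> K)"
    using funvec.short_word_leaving_subspace[where T = T and x = "g 0", OF T_lin T_E E_fin B_E K_sub B_K D(2,1) z_E z_K v(1)]
    by blast
  then obtain u j where u: "u \<in> lists \<Sigma>" "length u + card D \<le> card E"
    and j: "j < m" "foldr T u (g j) \<notin> K" by (auto simp: B_def)
  have "hits S u j \<noteq> card S" using j(2) sum_word[OF u(1)] by (simp add: K_def)
  \<comment> \<open>Composition with \<open>pos\<close> is injective since \<open>pos\<close> is
    onto, and it sends cyclic transforms to the \<open>f j\<close>. These lie in the span of
    \<open>D\<close> and \<open>z\<close>, whence the \<open>+ 1\<close>.\<close>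
  moreover have "ratvec.dim (cyc_span m (idx S)) \<le> card D + 1"
  proof -
    define pull :: "(nat \<Rightarrow> rat) \<Rightarrow> 'q \<Rightarrow> rat"
      where "pull h = (\<lambda>q. if q \<in> Q then h (pos q) else 0)" for h
    interpret pull: module_hom rscale fscale pull
      by unfold_locales (auto simp: pull_def fscale_def rscale_def fun_eq_iff)
    obtain A where A: "A \<subseteq> cyc_transform m (idx S) ` {..<m}" "ratvec.independent A"
      "card A = ratvec.dim (cyc_transform m (idx S) ` {..<m})"
      by (rule ratvec.basis_exists)
    have "ratvec.span A \<subseteq> {h. \<forall>i\<ge>m. h i = 0}"
      using A(1) by (intro ratvec.span_minimal)
        (auto simp: ratvec.subspace_def rscale_def cyc_transform_def)
    moreover have "inj_on pull {h. \<forall>i\<ge>m. h i = 0}"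
    proof (rule inj_onI)
      fix h h' assume h: "h \<in> {h. \<forall>i\<ge>m. h i = 0}" "h' \<in> {h. \<forall>i\<ge>m. h i = 0}"
        and eq: "pull h = pull h'"
      have "h i = h' i" if "i < m" for i
      proof -
        obtain q where "q \<in> Q" "pos q = i" using pos_surj[OF \<open>i < m\<close>] by auto
        then show ?thesis using fun_cong[OF eq, of q] by (simp add: pull_def)
      qed
      moreover have "h i = h' i" if "\<not> i < m" for i using h that by simp
      ultimately show "h = h'" by blast
    qed
    ultimately have inj: "inj_on pull (ratvec.span A)" by (rule inj_on_subset[rotated])
    have ind: "funvec.independent (pull ` A)"
      using A(2) inj by (rule pull.independent_injective_image)
    have "pull (cyc_transform m (idx S) j) = f j" for j
      using pos(1) by (auto simp: pull_def cyc_transform_def f_def fun_eq_iff funpow_pos_in_iff)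
    then have "pull ` A \<subseteq> f ` {..<m}" using A(1) by force
    also have "\<dots> \<subseteq> funvec.span (insert z D)"
    proof
      fix h assume "h \<in> f ` {..<m}"
      then obtain j where j: "j < m" "h = f j" by auto
      have "g j \<in> funvec.span (insert z D)"
        using D(3) j funvec.span_mono[of D "insert z D"] by (auto simp: B_def)
      moreover have "fscale r z \<in> funvec.span (insert z D)"
        by (intro funvec.span_scale funvec.span_base) simp
      ultimately have "g j + fscale r z \<in> funvec.span (insert z D)" by (rule funvec.span_add)
      then show "h \<in> funvec.span (insert z D)" by (simp add: g_def j)
    qed
    finally have "card (pull ` A) \<le> card (insert z D)"
      using funvec.independent_span_bound[of "insert z D"] ind D_fin by auto
    also have "\<dots> \<le> card D + 1" using card_insert_le_m1 by (simp add: card_insert_if D_fin)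
    finally show ?thesis
      using card_image[of pull A] inj_on_subset[OF inj ratvec.span_superset] A(3)
      by (simp add: cyc_span_def)
  qed
  moreover have "card E \<le> card Q" unfolding E_def by (rule card_image_le[OF finite_states])
  ultimately show ?thesis using u j(1) by (intro bexI[of _ u]) auto
qed

text \<open>The counts average to \<open>card S\<close> over \<open>j < m\<close> and are not all
  equal to it, so one is larger; they depend on \<open>j\<close> only modulo the period.\<close>

lemma short_expanding_word:
  assumes S: "S \<subseteq> C" and k: "0 < card S" "card S < m"
  shows "\<exists>u\<in>lists \<Sigma>. length u + ratvec.dim (cyc_span m (idx S)) \<le> card Q + 1 \<and>
    (\<exists>j<cyc_period m (idx S). card S < hits S u j)"
proof -
  obtain u j where u: "u \<in> lists \<Sigma>" "length u + ratvec.dim (cyc_span m (idx S)) \<le> card Q + 1"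
    and j: "j < m" "hits S u j \<noteq> card S"
    using short_unbalanced_word[OF assms] by blast
  have "\<exists>j<m. card S < hits S u j"
  proof (rule ccontr)
    assume "\<not> ?thesis"
    then have le: "hits S u i \<le> card S" if "i < m" for i using that by (meson not_less)
    have "(\<Sum>i<m. hits S u i) < (\<Sum>i<m. card S)"
      using j le by (intro sum_strict_mono_ex1) (auto intro!: bexI[of _ j] le_neq_implies_less)
    then show False using sum_hits[OF S u(1)] by simp
  qed
  then obtain j' where j': "card S < hits S u j'" by auto
  have "hits S u (j' mod cyc_period m (idx S)) = hits S u j'"
    unfolding hits_def using CQ act_in[OF u(1)] m
    by (intro arg_cong[where f = card] Collect_cong conj_cong refl)
      (auto simp: funpow_pos_in_iff mod_cyc_period[OF idx_subset] subset_iff)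
  moreover have "cyc_period m (idx S) \<ge> 1" using cyc_period(1)[OF idx_subset] m by simp
  ultimately show ?thesis using u j'
    by (intro bexI[of _ u] conjI exI[of _ "j' mod cyc_period m (idx S)"]) auto
qed

section \<open>Single expansion steps\<close>

lemma w_nonempty: "w \<noteq> []"
proof
  assume "w = []"
  then have "(t ^^ i) c = c" for i by (induction i) auto
  then have "inj_on (\<lambda>i. c) {..<m}" using enum by (simp add: bij_betw_def)
  from inj_onD[OF this, of 0 1] show False using m by simp
qed

lemma expansion_step:
  assumes S: "S \<subseteq> C" and k: "0 < card S" "card S < m"
  shows "\<exists>v\<in>lists \<Sigma>. length v + Dstar m (card S) \<le> card Q + 1 + length w * (l + m - 1) \<and>
    card S < card {q \<in> C. act \<delta> v q \<in> S}"
proof -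
  define p where "p = cyc_period m (idx S)"
  obtain u j where u: "u \<in> lists \<Sigma>" "length u + ratvec.dim (cyc_span m (idx S)) \<le> card Q + 1"
    and j: "j < p" "card S < hits S u j"
    using short_expanding_word[OF assms] unfolding p_def by blast
  have pm: "p \<le> m" unfolding p_def using m by (intro cyc_period_le idx_subset) auto
  \<comment> \<open>Since \<open>j < p\<close>, at least \<open>m - p\<close> copies of
    \<open>w\<close> are saved compared with exponent \<open>l + m - 1\<close>. Each has at least
    one letter, which pays for the \<open>m - p\<close> in \<open>Dstar\<close>.\<close>
  have "m - p \<le> length w * (m - p)" using w_nonempty by (cases w) auto
  moreover have "length w * (l + j) \<le> length w * (l + p - 1)" using j by (intro mult_left_mono) auto
  moreover have "length w * (l + p - 1) + length w * (m - p) = length w * (l + m - 1)"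
    using pm j by (subst add_mult_distrib2[symmetric]) simp
  moreover have "Dstar m (card S) \<le> m - p + ratvec.dim (cyc_span m (idx S))"
    using Dstar_le[OF idx_subset, of S] S by (simp add: card_idx p_def)
  ultimately have "length u + length w * (l + j) + Dstar m (card S)
      \<le> card Q + 1 + length w * (l + m - 1)"
    using u(2) by linarith
  then show ?thesis using u(1) j(2) power_word[of "l + j"] unfolding hits_def
    by (intro bexI[of _ "u @ concat (replicate (l + j) w)"])
      (auto simp: length_power act_power)
qed

text \<open>The state of the first step may be chosen freely on the cycle; choosing it according to the
  exponent \<open>j\<close> of \<open>short_expanding_word\<close> makes \<open>w\<^sup>j\<close> superfluous.\<close>

lemma first_step:
  "\<exists>p\<in>C. \<exists>v\<in>lists \<Sigma>. length v + Dstar m 1 \<le> card Q + 1 + length w * l \<and>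
    1 < card {q \<in> C. act \<delta> v q \<in> {p}}"
proof -
  have c: "c \<in> C" using bij_betwE[OF enum] m by (auto dest!: bspec[of _ _ 0])
  define S where "S = {c}"
  have S: "S \<subseteq> C" "card S = 1" using c by (auto simp: S_def)
  define per where "per = cyc_period m (idx S)"
  obtain u j where u: "u \<in> lists \<Sigma>" "length u + ratvec.dim (cyc_span m (idx S)) \<le> card Q + 1"
    and j: "j < per" "1 < hits S u j"
    using short_expanding_word[OF S(1)] S(2) m unfolding per_def by (metis zero_less_one)
  \<comment> \<open>A singleton has full period \<open>m\<close>, so only the dimension remains in
    the bound on \<open>Dstar m 1\<close>.\<close>
  have "m - per = 0"
  proof -
    have "idx S = {0}"
    proof -
      have "0 \<in> idx S" using m by (simp add: idx_def S_def)
      moreover have "card (idx S) = 1" using S card_idx by simp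
      ultimately show ?thesis by (auto simp: card_1_singleton_iff)
    qed
    then have "(\<lambda>i. (i + per) mod m) ` {0} = {0}" and "per \<ge> 1"
      using cyc_period[OF idx_subset, of S] m by (auto simp: per_def)
    then have "m dvd per" "per > 0" by auto
    then show ?thesis by (auto dest: dvd_imp_le)
  qed
  then have len: "length u + Dstar m 1 \<le> card Q + 1"
    using u(2) Dstar_le[OF idx_subset, of S] S by (simp add: card_idx per_def)
  define H where "H = {q \<in> C. (t ^^ (l + j)) (act \<delta> u q) \<in> S}"
  have H: "1 < card H" using j by (simp add: H_def hits_def)
  \<comment> \<open>After \<open>l\<close> steps the states are on the cycle, where \<open>t\<close>
    is injective: those that meet in \<open>c\<close> after \<open>j\<close> more steps already
    coincide.\<close>
  have sub: "\<exists>p\<in>C. H \<subseteq> {q \<in> C. (t ^^ l) (act \<delta> u q) \<in> {p}}"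
  proof -
    obtain h where h: "h \<in> H" using H by fastforce
    define p where "p = (t ^^ l) (act \<delta> u h)"
    have same: "(t ^^ l) (act \<delta> u q) = p" if q: "q \<in> H" for q
    proof -
      have Q: "act \<delta> u q \<in> Q" "act \<delta> u h \<in> Q" using q h CQ act_in[OF u(1)] by (auto simp: H_def)
      have "(pos (act \<delta> u q) + j) mod m \<in> idx S" "(pos (act \<delta> u h) + j) mod m \<in> idx S"
        using q h Q by (auto simp: H_def funpow_pos_in_iff)
      moreover have "card (idx S) = 1" using S card_idx by simp
      ultimately have "(pos (act \<delta> u q) + j) mod m = (pos (act \<delta> u h) + j) mod m"
        by (auto simp: card_1_singleton_iff)
      then have "pos (act \<delta> u q) mod m = pos (act \<delta> u h) mod m"
        by (rule mod_add_rcancel_nat)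
      then have "pos (act \<delta> u q) = pos (act \<delta> u h)" using pos(1) Q by simp
      then show ?thesis using pos(2) Q by (metis p_def)
    qed
    moreover have "p \<in> C" using h CQ act_in[OF u(1)] level by (auto simp: p_def H_def)
    ultimately show ?thesis by (auto simp: H_def)
  qed
  then obtain p where p: "p \<in> C" "H \<subseteq> {q \<in> C. (t ^^ l) (act \<delta> u q) \<in> {p}}" by blast
  have "card H \<le> card {q \<in> C. (t ^^ l) (act \<delta> u q) \<in> {p}}"
    using p(2) finite_C by (intro card_mono) auto
  then have "1 < card {q \<in> C. act \<delta> (u @ concat (replicate l w)) q \<in> {p}}"
    using H by (simp add: act_power)
  moreover have "u @ concat (replicate l w) \<in> lists \<Sigma>" using u(1) power_word[of l] by simp
  moreover have "length (u @ concat (replicate l w)) + Dstar m 1 \<le> card Q + 1 + length w * l"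
    using len by (simp only: length_append length_power)
  ultimately show ?thesis using p(1) by (intro bexI[of _ p] bexI[of _ "u @ concat (replicate l w)"] conjI)
qed

section \<open>Lengths of the steps and the reset word\<close>

definition step_cost :: "nat \<Rightarrow> int" where
  "step_cost k = int (card Q) + 1 + int (length w) * (int l + int m - 1) - int (Dstar m k)"

text \<open>An expansion may skip sizes; nonnegativity allows their costs to be added anyway. It
  holds because \<open>card Q + 1\<close> is at least \<open>m + 1\<close> and the multiple of
  \<open>length w\<close> at least \<open>m - 1\<close>.\<close>

lemma step_cost_nonneg:
  assumes "1 \<le> k" "k < m"
  shows "0 \<le> step_cost k"
proof -
  have "m \<le> card Q" using card_mono[OF finite_states CQ] card_C by simp
  moreover have "int (length w) * (int l + int m - 1) \<ge> 1 * (int l + int m - 1)"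
    using w_nonempty m by (intro mult_right_mono) (auto simp: Suc_le_eq)
  moreover have "Dstar m k < 2 * m" using assms by (intro Dstar_less) auto
  ultimately show ?thesis by (simp add: step_cost_def)
qed

text \<open>Sets are expanded backwards: \<open>v\<close> maps the larger set \<open>S'\<close> into
  \<open>S\<close>, so the word found for \<open>S'\<close> is read before \<open>v\<close>.\<close>

lemma cycle_into_subset:
  assumes "S \<subseteq> C" "0 < card S"
  shows "\<exists>v\<in>lists \<Sigma>. act \<delta> v ` C \<subseteq> S \<and> int (length v) \<le> (\<Sum>k\<in>{card S..<m}. step_cost k)"
  using assms
proof (induction "m - card S" arbitrary: S rule: less_induct)
  case less
  have le: "card S \<le> m" using card_mono[OF finite_C less.prems(1)] card_C by simp
  show ?case
  proof (cases "card S = m")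
    case True
    then have "S = C" using card_subset_eq[OF finite_C less.prems(1)] card_C by simp
    then show ?thesis using True by (intro bexI[of _ "[]"]) auto
  next
    case False
    then have lt: "card S < m" using le by simp
    obtain v where v: "v \<in> lists \<Sigma>" "length v + Dstar m (card S) \<le> card Q + 1 + length w * (l + m - 1)"
      and bigger: "card S < card {q \<in> C. act \<delta> v q \<in> S}"
      using expansion_step[OF less.prems lt] by blast
    define S' where "S' = {q \<in> C. act \<delta> v q \<in> S}"
    have "m - card S' < m - card S" using bigger lt by (simp add: S'_def)
    then obtain v' where v': "v' \<in> lists \<Sigma>" "act \<delta> v' ` C \<subseteq> S'"
      "int (length v') \<le> (\<Sum>k\<in>{card S'..<m}. step_cost k)"
      using less.hyps[of S'] bigger by (auto simp: S'_def)
    have "int (length w * (l + m - 1)) = int (length w) * (int l + int m - 1)"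
      using m by (simp add: of_nat_diff)
    then have "int (length v) \<le> step_cost (card S)" using v(2) unfolding step_cost_def by linarith
    moreover have "(\<Sum>k\<in>{card S'..<m}. step_cost k) \<le> (\<Sum>k\<in>{Suc (card S)..<m}. step_cost k)"
      using bigger by (intro sum_mono2) (auto simp: S'_def intro!: step_cost_nonneg)
    ultimately have "int (length (v' @ v)) \<le> (\<Sum>k\<in>{card S..<m}. step_cost k)"
      using v'(3) lt by (simp add: sum.atLeast_Suc_lessThan)
    then show ?thesis using v(1) v' by (intro bexI[of _ "v' @ v"]) (auto simp: S'_def)
  qed
qed

lemma short_reset_word:
  "\<exists>u. reset_word Q \<Sigma> \<delta> u \<and>
    int (length u) \<le> int (length w) * (int l + int m - 2) * (int m - 1)
      + (int (card Q) + 1) * (int m - 1) + int (length w) * int l - (\<Sum>k = 1..m - 1. int (Dstar m k))"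
proof -
  obtain p v where p: "p \<in> C" and v: "v \<in> lists \<Sigma>" "length v + Dstar m 1 \<le> card Q + 1 + length w * l"
    and bigger: "1 < card {q \<in> C. act \<delta> v q \<in> {p}}"
    using first_step by blast
  define S where "S = {q \<in> C. act \<delta> v q \<in> {p}}"
  obtain v' where v': "v' \<in> lists \<Sigma>" "act \<delta> v' ` C \<subseteq> S"
    "int (length v') \<le> (\<Sum>k\<in>{card S..<m}. step_cost k)"
    using cycle_into_subset[of S] bigger by (auto simp: S_def)
  define u where "u = concat (replicate l w) @ v' @ v"
  have "act \<delta> u q = p" if "q \<in> Q" for q
    using that level v'(2) by (auto simp: u_def act_power S_def)
  then have "act \<delta> u ` Q = {p}" using p CQ by auto
  then have "reset_word Q \<Sigma> \<delta> u"
    using power_word[of l] v(1) v'(1) by (simp add: reset_word_def u_def)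
  \<comment> \<open>The first step already yields at least two states and is charged
    separately.\<close>
  moreover have "(\<Sum>k\<in>{card S..<m}. step_cost k) \<le> (\<Sum>k\<in>{2..<m}. step_cost k)"
    using bigger by (intro sum_mono2) (auto simp: S_def intro!: step_cost_nonneg)
  then have "int (length u) \<le> int (length w) * int l + (\<Sum>k\<in>{2..<m}. step_cost k) + int (length v)"
    using v'(3) by (simp add: u_def length_power)
  moreover have "int (length v) \<le> int (card Q) + 1 + int (length w) * int l - int (Dstar m 1)"
    using v(2) by (simp flip: of_nat_mult)
  moreover have "(\<Sum>k\<in>{2..<m}. step_cost k) = (int m - 2) * (int (card Q) + 1
      + int (length w) * (int l + int m - 1)) - (\<Sum>k\<in>{2..<m}. int (Dstar m k))"
    using m by (simp add: step_cost_def sum_subtractf of_nat_diff)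
  moreover have "(\<Sum>k = 1..m - 1. int (Dstar m k)) = int (Dstar m 1) + (\<Sum>k\<in>{2..<m}. int (Dstar m k))"
  proof -
    have "{1..m - 1} = insert 1 {2..<m}" using m by auto
    then show ?thesis by simp
  qed
  \<comment> \<open>Beyond the prefix, the factors of \<open>length w\<close> add up by
    \<open>l + (m - 2) * (l + m - 1) = (l + m - 2) * (m - 1)\<close>.\<close>
  ultimately show ?thesis by (intro exI[of _ u] conjI) (auto simp: algebra_simps)
qed

end

theorem theorem4:
  fixes Q :: "'q set" and \<Sigma> :: "'a set" and \<delta> :: "'q \<Rightarrow> 'a \<Rightarrow> 'q"
    and w :: "'a list" and C :: "'q set" and n s l m :: nat
  assumes "automaton Q \<Sigma> \<delta>"
    and "synchronizing Q \<Sigma> \<delta>"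
    and "card Q = n"
    and "w \<in> lists \<Sigma>"
    and "length w = s"
    and "one_cluster Q (act \<delta> w)"
    and "is_cycle Q (act \<delta> w) C"
    and "card C = m"
    and "m > 1"
    and "level Q (act \<delta> w) C = l"
  shows "\<exists>u. reset_word Q \<Sigma> \<delta> u \<and>
    int (length u) \<le> int s * (int l + int m - 2) * (int m - 1) + (int n + 1) * (int m - 1)
      + int s * int l - (\<Sum>k = 1..m - 1. int (Dstar m k))"
proof -
  interpret automaton Q \<Sigma> \<delta> by fact
  have "cyclic_on (act \<delta> w) C" "C \<subseteq> Q" using assms(7) by (auto simp: is_cycle_def)
  then obtain c where "bij_betw (\<lambda>i. (act \<delta> w ^^ i) c) {..<m} C" "(act \<delta> w ^^ m) c = c"
    using cyclic_on_enum assms(8) by metis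
  then interpret cluster_word Q \<Sigma> \<delta> w C c l m
    using assms level_image[OF finite_states assms(6,7)] \<open>C \<subseteq> Q\<close> by unfold_locales auto
  show ?thesis using short_reset_word assms(3,5) by simp
qed

end
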